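(* Let $\mathcal{Y}$ be the set of sequences $(y(n))_{n\in\mathbb{N}}$ with $y(1)=1$ and $y(n)\in\{0,1\}$ for $n>1$. With each sequence $y\in\mathcal{Y}$ associate an infinite sequence of sets $S(y):=(s(n))_{n\in\mathbb{N}}$ by $$s(n):=\begin{cases}\{1\} & \text{if } y(n)=1,\\ \{1\}\cup\left(\{n+1\}-\{j \mid y(j)=1,\ 1\le j\le n\}\right) & \text{if } y(n)=0.\end{cases}$$ Let sequences $q=(q(n))_{n\in\mathbb{N}}$ be formed by choosing each term $q(n)$ from $s(n)$, independently for each $n$. Then all such $q$ are members of $\mathcal{Q}$ and, defining $q'(1)=1$ and $q'(n):=q(n-q(n-1))$ for $n>1$, we have $q'(n)=1$ for all $n\in\mathbb{N}$.
   Context: $\mathcal{Q}$ is the set of all infinite integer sequences $(q(n))_{n\in\mathbb{N}}$ (indexed from 1) with $1\le q(n)\le n$ for all $n\in\mathbb{N}$. For sets of integers $G,H$, $G-H:=\{g-h \mid g\in G,\ h\in H\}$ denotes the difference set. *)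

theory Defs
  imports Main
begin

text \<open>
  A sequence indexed from 1 is a function on \<^typ>\<open>nat\<close>; its value at 0 is
  irrelevant and is constrained nowhere.
\<close>

definition seqs_Q :: "(nat \<Rightarrow> int) set" where
  "seqs_Q = {q. \<forall>n\<ge>1. 1 \<le> q n \<and> q n \<le> int n}"

definition seqs_Y :: "(nat \<Rightarrow> int) set" where
  "seqs_Y = {y. y 1 = 1 \<and> (\<forall>n>1. y n \<in> {0, 1})}"

definition difference_set :: "int set \<Rightarrow> int set \<Rightarrow> int set" where
  "difference_set G H = {g - h | g h. g \<in> G \<and> h \<in> H}"

text \<open>For \<open>y\<close> in \<^const>\<open>seqs_Y\<close> and \<open>n \<ge> 1\<close> the second branch is the case \<open>y n = 0\<close>.\<close>

definition S :: "(nat \<Rightarrow> int) \<Rightarrow> nat \<Rightarrow> int set" where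
  "S y n = (if y n = 1 then {1}
            else {1} \<union> difference_set {int n + 1} {int j | j. y j = 1 \<and> 1 \<le> j \<and> j \<le> n})"

text \<open>
  For \<open>q\<close> in \<^const>\<open>seqs_Q\<close> and \<open>n > 1\<close> the index \<open>n - q (n - 1)\<close> is an integer
  between 1 and \<open>n - 1\<close>, so that \<^const>\<open>nat\<close> does not truncate.
\<close>

definition q_prime :: "(nat \<Rightarrow> int) \<Rightarrow> nat \<Rightarrow> int" where
  "q_prime q n = (if n = 1 then 1 else q (nat (int n - q (n - 1))))"

end

theory Submission
  imports Defs
begin

text \<open>
  A choice other than \<open>1\<close> from \<^term>\<open>S y n\<close> points back to a marked index, that is, to some
  \<open>j\<close> with \<open>y j = 1\<close>: if \<open>q n = n + 1 - j\<close>, then the index at which \<open>q_prime q (n + 1)\<close>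
  reads \<open>q\<close> is \<open>n + 1 - q n = j\<close>, and \<open>q j = 1\<close> is forced because \<^term>\<open>S y j\<close> is
  \<open>{1}\<close>. If instead \<open>q n = 1\<close>, then the index read is \<open>n\<close> itself, where the value is again
  \<open>1\<close>. No choice depends on an earlier one, which is why they can be made independently.
\<close>

lemma S_cases:
  assumes "x \<in> S y n"
  obtains "x = 1"
  | j where "y j = 1" "1 \<le> j" "j \<le> n" "x = int n + 1 - int j"
  using assms by (auto simp: S_def difference_set_def split: if_splits)

lemma S_bounds:
  assumes "x \<in> S y n" "n \<ge> 1"
  shows "1 \<le> x \<and> x \<le> int n"
  using assms(1) by (rule S_cases) (use assms(2) in auto)

text \<open>
  The case \<open>q n = 1\<close> is the only one that inspects the value at \<open>n\<close> itself; otherwise the index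
  reached is the marked \<open>j\<close> from which \<open>q n\<close> was formed, and no induction on \<open>n\<close> is needed.
\<close>

lemma value_one_at_look_back_index:
  fixes y q :: "nat \<Rightarrow> int"
  assumes q: "\<forall>n\<ge>1. q n \<in> S y n" and "n \<ge> 1"
  shows "q (nat (int (Suc n) - q n)) = 1"
proof -
  have "q n \<in> S y n"
    using assms by blast
  then show ?thesis
  proof (cases rule: S_cases)
    case 1
    then show ?thesis by simp
  next
    case (2 j)
    have "q j \<in> S y j"
      using q \<open>1 \<le> j\<close> by blast
    then have "q j = 1"
      using \<open>y j = 1\<close> by (simp add: S_def)
    moreover have "nat (int (Suc n) - q n) = j"
      using 2 by simp
    ultimately show ?thesis by simp
  qed
qed

theorem theorem3p8:
  fixes y q :: "nat \<Rightarrow> int"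
  assumes "y \<in> seqs_Y"
    and "\<forall>n\<ge>1. q n \<in> S y n"
  shows "q \<in> seqs_Q \<and> (\<forall>n\<ge>1. q_prime q n = 1)"
proof (intro conjI allI impI)
  show "q \<in> seqs_Q"
    unfolding seqs_Q_def using assms(2) S_bounds by blast
next
  fix n :: nat
  assume "n \<ge> 1"
  show "q_prime q n = 1"
  proof (cases "n = 1")
    case True
    then show ?thesis by (simp add: q_prime_def)
  next
    case False
    then have "n - 1 \<ge> 1" and "Suc (n - 1) = n"
      using \<open>n \<ge> 1\<close> by auto
    then have "q (nat (int n - q (n - 1))) = 1"
      using value_one_at_look_back_index[OF assms(2), of "n - 1"] by metis
    then show ?thesis
      using False by (simp add: q_prime_def)
  qed
qed

end
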